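(* Let $\Omega=\mathbb{R}$, let $f\colon(0,\infty)\to[0,\infty)$ be convex with $f\in C^2$ and $f(1)=f'(1)=0$. Let $p,q\in\mathcal{P}(\Omega)$, let $T$ be the monotone increasing map with $T_\#q=p$, and for $\lambda\in[0,1]$ let $$p_\lambda=\big((1-\lambda)\,\mathrm{id}+\lambda T\big)_\#q,\qquad \mathrm{id}(x)=x,$$ be the geodesic in Wasserstein-$2$ space connecting $q$ and $p$. Then $$\lim_{\lambda\to0}\frac{1}{\lambda^2}\,\mathrm{D}_{\mathrm{T},f}(p_\lambda\|q)=\frac{f''(1)}{2}\int_\Omega|T'(x)-1|^2\,q(x)\,dx .$$
   Context: $\mathcal{P}(\Omega)=\{p\in C^\infty(\Omega):\int_\Omega p(x)\,dx=1,\ p(x)>0 \text{ for all } x\}$. For $p,q\in\mathcal{P}(\Omega)$, the monotone increasing map $T$ with $T_\#q=p$ (push-forward of $q\,dx$ to $p\,dx$) is $T(x)=F_p^{-1}(F_q(x))$, where $F_p,F_q$ are the cumulative distribution functions; it satisfies $p(T(x))\,T'(x)=q(x)$. Definition (transport $f$-divergence): $$\mathrm{D}_{\mathrm{T},f}(p\|q)=\int_\Omega f\Big(\frac{q(x)}{p(T(x))}\Big)q(x)\,dx .$$ The limit is taken over $\lambda\in(0,1]$, $\lambda\to0$.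
   Formalization: Added: if the right-hand side is finite (0·∞ read as 0), the integrands f(q/p_λ(T_λ))/λ² are, for small λ>0, a.e. bounded by some g with gq integrable. Without it the claim fails, e.g. f(u)=exp(u-1)-u, q standard normal, T(x)=x+x^5. *)

theory Defs
  imports "HOL-Probability.Probability"
begin

definition smooth :: "(real \<Rightarrow> real) \<Rightarrow> bool" where
  "smooth p \<longleftrightarrow> (\<forall>k x. ((deriv ^^ k) p) differentiable (at x))"

definition prob_densities :: "(real \<Rightarrow> real) set" where
  "prob_densities = {p. smooth p \<and> has_bochner_integral lborel p 1 \<and> (\<forall>x. 0 < p x)}"

definition measure_of_density :: "(real \<Rightarrow> real) \<Rightarrow> real measure" where
  "measure_of_density p = density lborel (\<lambda>x. ennreal (p x))"

definition transports :: "(real \<Rightarrow> real) \<Rightarrow> (real \<Rightarrow> real) \<Rightarrow> (real \<Rightarrow> real) \<Rightarrow> bool" where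
  "transports S q r \<longleftrightarrow> distr (measure_of_density q) lborel S = measure_of_density r"

(* Densities are evaluated pointwise below, so the push-forward density has to be a function
   and not an equivalence class modulo null sets: we select the continuous representative,
   which is unique. Nonnegativity is needed because ennreal truncates negative values. *)
definition pushforward_density :: "(real \<Rightarrow> real) \<Rightarrow> (real \<Rightarrow> real) \<Rightarrow> real \<Rightarrow> real" where
  "pushforward_density S q =
     (THE r. continuous_on UNIV r \<and> (\<forall>x. 0 \<le> r x) \<and> transports S q r)"

definition transport_map :: "(real \<Rightarrow> real) \<Rightarrow> (real \<Rightarrow> real) \<Rightarrow> real \<Rightarrow> real" where
  "transport_map p q x = inv (cdf (measure_of_density p)) (cdf (measure_of_density q) x)"

definition transport_ratio :: "(real \<Rightarrow> real) \<Rightarrow> (real \<Rightarrow> real) \<Rightarrow> real \<Rightarrow> real" where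
  "transport_ratio p q x = q x / p (transport_map p q x)"

(* The integrand is nonnegative in the intended use (f \<ge> 0 on the positive reals), so the
   divergence is always defined as an element of [0, \<infinity>]. *)
definition transport_f_divergence ::
    "(real \<Rightarrow> real) \<Rightarrow> (real \<Rightarrow> real) \<Rightarrow> (real \<Rightarrow> real) \<Rightarrow> ennreal" where
  "transport_f_divergence f p q = (\<integral>\<^sup>+x. ennreal (f (transport_ratio p q x) * q x) \<partial>lborel)"

definition wasserstein_geodesic :: "(real \<Rightarrow> real) \<Rightarrow> (real \<Rightarrow> real) \<Rightarrow> real \<Rightarrow> real \<Rightarrow> real" where
  "wasserstein_geodesic q T t = pushforward_density (\<lambda>x. (1 - t) * x + t * T x) q"

(* Domination of the integrands of D(P t || q) / t^2 near t = 0 by a function integrable with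
   respect to q dx. Without it the limit and the integral need not commute: for
   f u = exp (u - 1) - u, q the standard normal density and T x = x + x^5, the divergence
   D(P t || q) along the geodesic P is infinite for every t > 0, while the q-integral of (T' - 1)^2 is finite. *)
definition dominated_near_zero ::
    "(real \<Rightarrow> real) \<Rightarrow> (real \<Rightarrow> real \<Rightarrow> real) \<Rightarrow> (real \<Rightarrow> real) \<Rightarrow> bool" where
  "dominated_near_zero f P q \<longleftrightarrow>
     (\<exists>g. integrable lborel (\<lambda>x. g x * q x) \<and>
        (\<forall>\<^sub>F t in at_right 0. AE x in lborel. f (transport_ratio (P t) q x) / t^2 \<le> g x))"

end

theory Submission imports Defs begin

text \<open>A monotone map \<open>S\<close> pushing \<open>q\<close> to \<open>r\<close> satisfies \<open>F\<^sub>r (S x) = F\<^sub>q x\<close> at every point \<open>x\<close>.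
  Hence \<open>T\<close> is continuously differentiable with \<open>T' = q / p \<circ> T > 0\<close>, and for \<open>0 < t < 1\<close> the map
  \<open>S\<^sub>t = (1 - t) id + t T\<close> is a \<open>C\<^sup>1\<close> diffeomorphism of the line (onto, because of the summand
  \<open>(1 - t) id\<close>). So \<open>S\<^sub>t\<close> is the transport map from \<open>q\<close> to \<open>p\<^sub>t\<close>, and
  \<open>q x / p\<^sub>t (S\<^sub>t x) = S\<^sub>t' x = 1 + t (T' x - 1)\<close>. By Taylor expansion
  \<open>f (1 + t h) / t\<^sup>2\<close> tends to \<open>f'' 1 / 2 * h\<^sup>2\<close> pointwise; the integrals converge by domination if
  the limit is finite, and by Fatou's lemma if it is infinite.\<close>

section \<open>Densities and the measures they define\<close>

lemma prob_densities_continuous: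
  assumes "p \<in> prob_densities"
  shows "continuous_on UNIV p"
proof -
  have "((deriv ^^ 0) p) differentiable (at x)" for x
    using assms unfolding prob_densities_def smooth_def by blast
  then show ?thesis
    by (simp add: continuous_at_imp_continuous_on differentiable_imp_continuous_within)
qed

lemma prob_densities_pos: "p \<in> prob_densities \<Longrightarrow> 0 < p x"
  by (simp add: prob_densities_def)

lemma sets_measure_of_density [simp, measurable_cong]: "sets (measure_of_density r) = sets borel"
  and space_measure_of_density [simp]: "space (measure_of_density r) = UNIV"
  by (simp_all add: measure_of_density_def)

lemma emeasure_measure_of_density:
  assumes [measurable]: "r \<in> borel_measurable borel" "A \<in> sets borel"
  shows "emeasure (measure_of_density r) A = (\<integral>\<^sup>+x. ennreal (r x) * indicator A x \<partial>lborel)"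
  by (simp add: measure_of_density_def emeasure_density)

lemma measure_of_density_singleton:
  assumes [measurable]: "r \<in> borel_measurable borel"
  shows "measure (measure_of_density r) {x} = 0"
proof -
  have "AE y in lborel. y \<in> {x} \<longrightarrow> ennreal (r y) = 0"
    using AE_lborel_singleton[of x] by eventually_elim simp
  then have "{x} \<in> null_sets (measure_of_density r)"
    unfolding measure_of_density_def by (intro null_sets_density_iff[THEN iffD2] conjI) auto
  then show ?thesis
    by (simp add: null_setsD1 measure_def)
qed

lemma real_distribution_prob_density:
  assumes "p \<in> prob_densities"
  shows "real_distribution (measure_of_density p)"
proof -
  have "has_bochner_integral lborel p 1" "\<And>x. 0 < p x"
    using assms by (auto simp: prob_densities_def)
  then have "(\<integral>\<^sup>+x. ennreal (p x) \<partial>lborel) = 1"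
    using nn_integral_eq_integral[of lborel p] by (auto simp: has_bochner_integral_iff less_imp_le)
  moreover have "p \<in> borel_measurable borel"
    using prob_densities_continuous[OF assms] by (rule borel_measurable_continuous_onI)
  ultimately have "emeasure (measure_of_density p) UNIV = 1"
    by (simp add: emeasure_measure_of_density)
  then show ?thesis
    unfolding real_distribution_def real_distribution_axioms_def
    by (auto intro!: prob_spaceI)
qed

text \<open>Total mass is preserved by a push-forward, so \<open>r\<close> is normalised without
  being assumed to lie in \<open>prob_densities\<close>. This makes the distribution functions of
  the intermediate densities on the geodesic available.\<close>

lemma real_distribution_transports:
  assumes "transports S q r" "real_distribution (measure_of_density q)" "mono S"
  shows "real_distribution (measure_of_density r)"
proof -
  interpret real_distribution "measure_of_density q" by fact
  have "S \<in> borel_measurable (measure_of_density q)"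
    using borel_measurable_mono[OF \<open>mono S\<close>] by (simp cong: measurable_cong_sets)
  then have "prob_space (measure_of_density r)"
    using assms(1) prob_space_distr[of S lborel] unfolding transports_def by simp
  then show ?thesis
    unfolding real_distribution_def real_distribution_axioms_def by simp
qed

section \<open>Distribution functions and monotone transport\<close>

lemma DERIV_cdf_measure_of_density:
  assumes cont: "continuous_on UNIV r" and nonneg: "\<And>x. 0 \<le> r x"
    and dist: "real_distribution (measure_of_density r)"
  shows "(cdf (measure_of_density r) has_real_derivative r x) (at x)"
proof -
  interpret real_distribution "measure_of_density r" by fact
  have [measurable]: "r \<in> borel_measurable borel"
    using cont by (rule borel_measurable_continuous_onI)
  \<comment> \<open>Any base point strictly left of \<open>x\<close> would do: \<open>x\<close> is
    then interior to \<open>{a..x+1}\<close>, so the one-sided derivative from the fundamental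
    theorem is a full one, and \<open>eq\<close> covers a neighbourhood of \<open>x\<close>.\<close>
  define a where "a = x - 1"
  have eq: "cdf (measure_of_density r) u = cdf (measure_of_density r) a + (LBINT y=a..u. r y)"
    if "a < u" for u
  proof -
    have "cdf (measure_of_density r) u - cdf (measure_of_density r) a
        = measure (measure_of_density r) {a<..u}"
      using that by (rule cdf_diff_eq)
    also have "\<dots> = enn2real (\<integral>\<^sup>+y. ennreal (indicator {a<..u} y * r y) \<partial>lborel)"
      unfolding measure_def
      by (subst emeasure_measure_of_density)
         (simp_all add: ennreal_mult'[OF nonneg] mult.commute ennreal_indicator)
    also have "\<dots> = (LBINT y. indicator {a<..u} y * r y)"
      using nonneg by (subst integral_eq_nn_integral) auto
    also have "\<dots> = (LBINT y=a..u. r y)"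
      using that by (simp add: interval_integral_Ioc set_lebesgue_integral_def)
    finally show ?thesis by simp
  qed
  have "((\<lambda>u. LBINT y=a..u. r y) has_vector_derivative r x) (at x within {a..x+1})"
    by (intro interval_integral_FTC2 continuous_on_subset[OF cont]) (simp_all add: a_def)
  then have "((\<lambda>u. LBINT y=a..u. r y) has_real_derivative r x) (at x)"
    by (simp add: has_real_derivative_iff_has_vector_derivative at_within_Icc_at a_def)
  then have "((\<lambda>u. cdf (measure_of_density r) a + (LBINT y=a..u. r y)) has_real_derivative r x) (at x)"
    by (auto intro!: derivative_eq_intros)
  moreover have "\<forall>\<^sub>F u in nhds x. cdf (measure_of_density r) a + (LBINT y=a..u. r y)
      = cdf (measure_of_density r) u"
  proof -
    have "\<forall>\<^sub>F u in nhds x. u \<in> {a<..}"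
      by (rule eventually_nhds_in_open) (auto simp: a_def)
    then show ?thesis
      by eventually_elim (simp add: eq)
  qed
  ultimately show ?thesis
    by (simp only: DERIV_cong_ev[OF refl _ refl])
qed

lemma strict_mono_DERIV_pos:
  fixes f f' :: "real \<Rightarrow> real"
  assumes "\<And>x. (f has_real_derivative f' x) (at x)" "\<And>x. 0 < f' x"
  shows "strict_mono f"
proof (rule strict_monoI)
  fix x y :: real
  assume "x < y"
  then show "f x < f y"
    by (rule DERIV_pos_imp_increasing) (use assms in blast)
qed

lemma strict_mono_cdf_measure_of_density:
  assumes "continuous_on UNIV r" "\<And>x. 0 < r x" "real_distribution (measure_of_density r)"
  shows "strict_mono (cdf (measure_of_density r))"
  using DERIV_cdf_measure_of_density[OF assms(1) less_imp_le[OF assms(2)] assms(3)] assms(2)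
  by (rule strict_mono_DERIV_pos)

text \<open>A monotone \<open>S\<close> satisfies \<open>S -` {..<S x} \<subseteq> {..x} \<subseteq> S -` {..S x}\<close>,
  and \<open>{..<S x}\<close> and \<open>{..S x}\<close> have the same mass under a measure with a density.\<close>
lemma cdf_transports:
  assumes "mono S" and tr: "transports S q r" and dist: "real_distribution (measure_of_density q)"
    and [measurable]: "r \<in> borel_measurable borel"
  shows "cdf (measure_of_density r) (S x) = cdf (measure_of_density q) x"
proof (rule antisym)
  interpret q: real_distribution "measure_of_density q" by fact
  interpret r: real_distribution "measure_of_density r"
    by (rule real_distribution_transports[OF tr dist \<open>mono S\<close>])
  have [measurable]: "S \<in> borel_measurable borel"
    using \<open>mono S\<close> by (rule borel_measurable_mono)
  have *: "measure (measure_of_density r) A = measure (measure_of_density q) (S -` A)"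
    if "A \<in> sets borel" for A
    using that tr[unfolded transports_def, symmetric] by (simp add: measure_distr)
  have meas: "S -` A \<in> sets borel" if "A \<in> sets borel" for A
    using measurable_sets[of S borel borel A] that by simp
  have "measure (measure_of_density r) {..S x}
      = measure (measure_of_density r) {..<S x} + measure (measure_of_density r) {S x}"
    by (subst r.finite_measure_Union[symmetric]) (auto intro!: arg_cong[where f="measure _"])
  also have "\<dots> = measure (measure_of_density q) (S -` {..<S x})"
    by (simp add: measure_of_density_singleton *)
  also have "\<dots> \<le> measure (measure_of_density q) {..x}"
  proof (rule q.finite_measure_mono)
    show "S -` {..<S x} \<subseteq> {..x}"
      using monoD[OF \<open>mono S\<close>, of x] by auto (metis linear not_le)
  qed simp
  finally show "cdf (measure_of_density r) (S x) \<le> cdf (measure_of_density q) x"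
    by (simp add: cdf_def)
  have "measure (measure_of_density q) {..x} \<le> measure (measure_of_density q) (S -` {..S x})"
    by (rule q.finite_measure_mono) (use \<open>mono S\<close> in \<open>auto simp: mono_def meas\<close>)
  then show "cdf (measure_of_density q) x \<le> cdf (measure_of_density r) (S x)"
    by (simp add: cdf_def *)
qed

section \<open>Regularity of a factor through a strictly increasing function\<close>

text \<open>Strict monotonicity makes \<open>l < T y\<close> equivalent to \<open>G l < F y\<close>,
  so bounds on \<open>F\<close> near \<open>x\<close> become bounds on \<open>T\<close>. The
  derivative is then the quotient of the Caratheodory slopes of \<open>F\<close> and
  \<open>G\<close>. In use, \<open>G\<close> is the distribution function of \<open>p\<close> with
  \<open>T\<close> the transport map, or a diffeomorphism with \<open>T\<close> its inverse and
  \<open>F\<close> the identity.\<close>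

lemma
  fixes F G T :: "real \<Rightarrow> real"
  assumes G: "strict_mono G" and eq: "\<And>y. G (T y) = F y" 
  shows isCont_strict_mono_factor: "isCont F x \<Longrightarrow> isCont T x"
    and DERIV_strict_mono_factor:
      "(F has_real_derivative a) (at x) \<Longrightarrow> (G has_real_derivative b) (at (T x)) \<Longrightarrow> b \<noteq> 0 \<Longrightarrow>
        (T has_real_derivative a / b) (at x)"
proof -
  show cont: "isCont T x" if "isCont F x"
    unfolding isCont_def
  proof (rule order_tendstoI)
    fix l assume "l < T x"
    then have "G l < F x" using G by (simp add: strict_mono_less flip: eq)
    then have "\<forall>\<^sub>F y in at x. G l < F y"
      using that unfolding isCont_def by (rule order_tendstoD(1)[rotated])
    then show "\<forall>\<^sub>F y in at x. l < T y"
      using G by (simp add: strict_mono_less flip: eq)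
  next
    fix l assume "T x < l"
    then have "F x < G l" using G by (simp add: strict_mono_less flip: eq)
    then have "\<forall>\<^sub>F y in at x. F y < G l"
      using that unfolding isCont_def by (rule order_tendstoD(2)[rotated])
    then show "\<forall>\<^sub>F y in at x. T y < l"
      using G by (simp add: strict_mono_less flip: eq)
  qed
  assume F': "(F has_real_derivative a) (at x)" and G': "(G has_real_derivative b) (at (T x))"
    and "b \<noteq> 0"
  obtain h where h: "\<And>z. G z - G (T x) = h z * (z - T x)" "isCont h (T x)" "h (T x) = b"
    using G' by (auto simp: CARAT_DERIV)
  obtain k where k: "\<And>z. F z - F x = k z * (z - x)" "isCont k x" "k x = a"
    using F' by (auto simp: CARAT_DERIV)
  have "isCont T x" using cont F' DERIV_isCont by blast
  \<comment> \<open>Away from \<open>T x\<close> a zero of the slope would contradict injectivity of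
    \<open>G\<close>; at \<open>T x\<close> the slope is \<open>b\<close>.\<close>
  have h0: "h z \<noteq> 0" for z
    using h(1)[of z] h(3) \<open>b \<noteq> 0\<close> strict_mono_eq[OF G, of z "T x"] by (cases "z = T x") auto
  show "(T has_real_derivative a / b) (at x)"
    unfolding CARAT_DERIV
  proof (intro exI conjI allI)
    show "T z - T x = k z / h (T z) * (z - x)" for z
      using h(1)[of "T z"] k(1)[of z] h0[of "T z"] by (simp add: eq field_simps)
    show "isCont (\<lambda>z. k z / h (T z)) x"
      using k(2) h(2) \<open>isCont T x\<close> h0 by (intro continuous_intros isCont_o2[of x T h]) auto
  qed (simp add: h k)
qed

section \<open>Push-forward densities and transport ratios\<close>

text \<open>The set of disagreement is open, and a nonempty open set is not negligible. This is the
  uniqueness behind the \<open>THE\<close> in \<open>pushforward_density\<close>.\<close>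

lemma continuous_AE_lborel_eq:
  fixes f g :: "real \<Rightarrow> real"
  assumes "continuous_on UNIV f" "continuous_on UNIV g" "AE x in lborel. f x = g x"
  shows "f = g"
proof (rule ccontr)
  assume "f \<noteq> g"
  moreover have "open {x. f x \<noteq> g x}"
    using assms(1,2) by (rule open_Collect_neq)
  ultimately have "\<not> negligible {x. f x \<noteq> g x}"
    using open_not_negligible[of "{x. f x \<noteq> g x}"] by auto
  moreover have "AE x in lebesgue. f x = g x"
    using assms(3) by (rule AE_completion)
  then have "negligible {x. f x \<noteq> g x}"
    using AE_iff_null_sets[of "{x. f x \<noteq> g x}" lebesgue] \<open>open {x. f x \<noteq> g x}\<close>
    by (simp add: negligible_iff_null_sets AE_iff_null_sets)
  ultimately show False by simp
qed

lemma pushforward_density_eqI: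
  assumes "continuous_on UNIV r" "\<And>x. 0 \<le> r x" "transports S q r"
  shows "pushforward_density S q = r"
  unfolding pushforward_density_def
proof (rule the_equality)
  fix r' assume r': "continuous_on UNIV r' \<and> (\<forall>x. 0 \<le> r' x) \<and> transports S q r'"
  then have "density lborel r' = density lborel r"
    using assms(3) by (simp add: transports_def measure_of_density_def)
  moreover have [measurable]: "r \<in> borel_measurable borel" "r' \<in> borel_measurable borel"
    using assms(1) r' by (auto intro: borel_measurable_continuous_onI)
  ultimately have "AE x in lborel. ennreal (r' x) = ennreal (r x)"
    by (subst (asm) sigma_finite_measure.density_unique_iff[OF sigma_finite_lborel]) simp_all
  \<comment> \<open>Nonnegativity of both densities lets the equality descend from
    \<open>ennreal\<close> to the reals.\<close>
  then have "AE x in lborel. r' x = r x"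
    using assms(2) r' by auto
  then show "r' = r"
    using assms(1) r' by (intro continuous_AE_lborel_eq) auto
qed (simp add: assms)

text \<open>\<open>r\<close> solves the Jacobian equation \<open>r (S x) * S' x = q x\<close>. The
  change of variables is done through distribution functions: \<open>G = F_q o inv S\<close> is an
  antiderivative of \<open>r\<close> and also the distribution function of the image measure, and
  half lines determine a measure on the line.\<close>

lemma transports_diffeomorphism:
  fixes S S' q :: "real \<Rightarrow> real"
  assumes q: "continuous_on UNIV q" "\<And>x. 0 \<le> q x" "real_distribution (measure_of_density q)"
    and S: "\<And>x. (S has_real_derivative S' x) (at x)" "\<And>x. 0 < S' x" "continuous_on UNIV S'" "surj S"
  defines "r \<equiv> \<lambda>y. q (inv S y) / S' (inv S y)"
  shows "continuous_on UNIV r" "transports S q r"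
proof -
  interpret real_distribution "measure_of_density q" by fact
  have smono: "strict_mono S" using S(1,2) by (rule strict_mono_DERIV_pos)
  have SR: "S (inv S y) = y" for y using \<open>surj S\<close> by (rule surj_f_inv_f)
  have R_le: "inv S y \<le> x \<longleftrightarrow> y \<le> S x" for x y
    using strict_mono_less_eq[OF smono, of "inv S y" x] by (simp add: SR)
  have cR: "isCont (inv S) y" for y
    using isCont_strict_mono_factor[OF smono, of "inv S" "\<lambda>y. y"] SR by simp
  then have contR: "continuous_on UNIV (inv S)"
    by (simp add: continuous_at_imp_continuous_on)
  show cont_r: "continuous_on UNIV r"
    unfolding r_def
    using S(2) by (intro continuous_on_divide continuous_on_compose2[OF q(1) contR]
        continuous_on_compose2[OF S(3) contR]) (auto simp: less_imp_neq[symmetric])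
  then have [measurable]: "r \<in> borel_measurable borel"
    by (rule borel_measurable_continuous_onI)
  have [measurable]: "S \<in> borel_measurable borel"
    using strict_mono_mono[OF smono] by (rule borel_measurable_mono)
  have r_nonneg: "0 \<le> r y" for y using q(2) S(2) by (simp add: r_def less_imp_le)
  define G where "G = (\<lambda>y. cdf (measure_of_density q) (inv S y))"
  have G': "(G has_real_derivative r y) (at y)" for y
  proof -
    have "(inv S has_real_derivative 1 / S' (inv S y)) (at y)"
      using S(2)[of "inv S y"] SR
      by (intro DERIV_strict_mono_factor[OF smono, of "inv S" "\<lambda>y. y"] S(1)) auto
    from DERIV_chain2[OF DERIV_cdf_measure_of_density[OF q] this] show ?thesis
      by (simp add: G_def r_def)
  qed
  \<comment> \<open>By \<open>R_le\<close>, the bound \<open>inv S y \<le> z\<close> holds for every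
    \<open>y \<le> S z\<close>.\<close>
  have "filterlim (inv S) at_bot at_bot"
    unfolding filterlim_at_bot eventually_at_bot_linorder R_le by blast
  then have G_lim: "(G \<longlongrightarrow> 0) at_bot"
    unfolding G_def by (rule filterlim_compose[OF cdf_lim_at_bot])
  have "distributed (measure_of_density q) lborel S r"
  proof (rule distributedI_borel_atMost[where g=G])
    show "(\<integral>\<^sup>+x. ennreal (r x * indicator {..a} x) \<partial>lborel) = ennreal (G a)" for a
    proof -
      \<comment> \<open>The reflection of the line turns \<open>{..a}\<close> into
        \<open>{- a..}\<close>, where the fundamental theorem for half lines applies to the
        antiderivative \<open>- G (- x)\<close>, which tends to 0 at infinity.\<close>
      have "(\<integral>\<^sup>+x. ennreal (r x * indicator {..a} x) \<partial>lborel)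
          = (\<integral>\<^sup>+x. ennreal (r (- x)) * indicator {- a..} x \<partial>lborel)"
        by (subst nn_integral_real_affine[where c="-1" and t=0])
           (auto intro!: nn_integral_cong simp: indicator_def)
      also have "\<dots> = ennreal (0 - (- G (- (- a))))"
      proof (rule nn_integral_FTC_atLeast)
        show "((\<lambda>x. - G (- x)) has_real_derivative r (- x)) (at x)" for x
          using DERIV_minus[OF DERIV_chain2[OF G', of uminus "-1" x UNIV]]
            DERIV_minus[OF DERIV_ident, of x UNIV] by simp
        show "((\<lambda>x. - G (- x)) \<longlongrightarrow> 0) at_top"
          using G_lim by (auto simp: filterlim_at_bot_mirror intro: tendsto_eq_intros)
      qed (auto simp: r_nonneg)
      finally show ?thesis by simp
    qed
    show "emeasure (measure_of_density q) {x \<in> space (measure_of_density q). S x \<le> a} = ennreal (G a)" for a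
    proof -
      have "{x \<in> space (measure_of_density q). S x \<le> a} = {..inv S a}"
        using strict_mono_less_eq[OF smono, of _ "inv S a"] by (auto simp: SR)
      then show ?thesis
        by (simp add: G_def cdf_def emeasure_eq_measure)
    qed
  qed (auto simp: r_nonneg)
  then show "transports S q r"
    by (simp add: transports_def measure_of_density_def distributed_distr_eq_density)
qed

text \<open>The argument of \<open>inv\<close> is \<open>F_q x = F_r (S x)\<close>, hence in the
  range of \<open>F_r\<close>, and strict monotonicity of \<open>F_r\<close> leaves
  \<open>S x\<close> as its only preimage.\<close>

lemma transport_map_eqI:
  assumes "mono S" "transports S q r" "real_distribution (measure_of_density q)"
    and "continuous_on UNIV r" "\<And>x. 0 < r x"
  shows "transport_map r q x = S x"
proof -
  have "strict_mono (cdf (measure_of_density r))"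
    using assms(4,5) real_distribution_transports[OF assms(2,3,1)]
    by (rule strict_mono_cdf_measure_of_density)
  then have "inj (cdf (measure_of_density r))"
    by (rule strict_mono_imp_inj_on)
  then show ?thesis
    unfolding transport_map_def
      cdf_transports[OF assms(1-3) borel_measurable_continuous_onI[OF assms(4)], symmetric]
    by (rule inv_f_f)
qed

text \<open>The map \<open>S\<close> is itself the transport map to the Jacobian density
  \<open>r\<close>, and \<open>r (S x) = q x / S' x\<close>, so \<open>q x\<close> cancels in the
  ratio.\<close>

lemma transport_ratio_pushforward_density:
  fixes S S' q :: "real \<Rightarrow> real"
  assumes q: "continuous_on UNIV q" "\<And>x. 0 < q x" "real_distribution (measure_of_density q)"
    and S: "\<And>x. (S has_real_derivative S' x) (at x)" "\<And>x. 0 < S' x" "continuous_on UNIV S'" "surj S"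
  shows "transport_ratio (pushforward_density S q) q x = S' x"
proof -
  define r where "r = (\<lambda>y. q (inv S y) / S' (inv S y))"
  have q0: "0 \<le> q x" for x using q(2) by (rule less_imp_le)
  note r = transports_diffeomorphism[OF q(1) q0 q(3) S, folded r_def]
  have r_pos: "0 < r y" for y using q(2) S(2) by (simp add: r_def)
  have "strict_mono S" using S(1,2) by (rule strict_mono_DERIV_pos)
  then have "mono S" "inj S" by (auto intro: strict_mono_mono strict_mono_imp_inj_on)
  have "pushforward_density S q = r"
    using r r_pos by (intro pushforward_density_eqI less_imp_le) 
  moreover have "transport_map r q x = S x"
    using \<open>mono S\<close> r q(3) r_pos by (intro transport_map_eqI)
  ultimately show ?thesis
    using q(2)[of x] by (simp add: transport_ratio_def r_def inv_f_f[OF \<open>inj S\<close>])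
qed

section \<open>Surjectivity of the interpolation; limits of integrands and of integrals\<close>

lemma surj_convex_combination_mono:
  fixes T :: "real \<Rightarrow> real"
  assumes "mono T" "continuous_on UNIV T" "0 \<le> t" "t < 1"
  shows "surj (\<lambda>x. (1 - t) * x + t * T x)"
  unfolding surj_def
proof
  fix y
  define S where "S = (\<lambda>x. (1 - t) * x + t * T x)"
  \<comment> \<open>Chosen so that the linear part alone covers the distance from
    \<open>t * T 0\<close> to \<open>y\<close>; monotonicity of \<open>T\<close> only helps, and
    \<open>y\<close> is caught between \<open>S (- c)\<close> and \<open>S c\<close>.\<close>
  define c where "c = \<bar>y - t * T 0\<bar> / (1 - t)"
  have c: "0 \<le> c" "(1 - t) * c = \<bar>y - t * T 0\<bar>" using assms(4) by (auto simp: c_def)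
  have "t * T (- c) \<le> t * T 0" "t * T 0 \<le> t * T c"
    using assms(1,3) c(1) by (auto intro!: mult_left_mono simp: mono_def)
  then have "S (- c) \<le> y" "y \<le> S c"
    using c(2) by (auto simp: S_def)
  moreover have "continuous_on {- c..c} S"
    unfolding S_def by (intro continuous_intros continuous_on_subset[OF assms(2)]) auto
  ultimately show "\<exists>x. y = (1 - t) * x + t * T x"
    using IVT'[of S "- c" y c] c(1) by (auto simp: S_def)
qed

text \<open>One application of l'Hopital's rule suffices: the new quotient is half a difference
  quotient at \<open>t = 0\<close>, because \<open>deriv f 1 = 0\<close>.\<close>

lemma second_order_Taylor_limit:
  fixes f :: "real \<Rightarrow> real"
  assumes "f differentiable_on {0<..}" "deriv f differentiable_on {0<..}" "f 1 = 0" "deriv f 1 = 0"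
  shows "((\<lambda>t. f (1 + t * h) / t\<^sup>2) \<longlongrightarrow> deriv (deriv f) 1 / 2 * h\<^sup>2) (at_right 0)"
proof (rule lhopital_right_0)
  have D: "(g has_real_derivative deriv g u) (at u)" if "g differentiable_on {0<..}" "0 < u" 
    for g :: "real \<Rightarrow> real" and u
    using that by (metis DERIV_deriv_iff_real_differentiable differentiable_on_eq_differentiable_at
        greaterThan_iff open_greaterThan)
  \<comment> \<open>As \<open>h\<close> may be very negative, the argument stays in the domain of
    \<open>f\<close> only for small \<open>t\<close>.\<close>
  have "((\<lambda>t. 1 + t * h) \<longlongrightarrow> 1) (at_right 0)"
    by (auto intro!: tendsto_eq_intros)
  then have pos: "\<forall>\<^sub>F t in at_right 0. 0 < 1 + t * h"
    by (rule order_tendstoD) simp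
  have d1: "((\<lambda>t. f (1 + t * h)) has_real_derivative deriv f (1 + t * h) * h) (at t)"
    if "0 < 1 + t * h" for t
    using D[OF assms(1) that] by (rule DERIV_chain2) (auto intro!: derivative_eq_intros)
  show "((\<lambda>t. f (1 + t * h)) \<longlongrightarrow> 0) (at_right 0)"
    using DERIV_isCont[OF d1[of 0]] assms(3) by (auto simp: isCont_def intro: filterlim_mono at_le tendsto_within_subset)
  show "\<forall>\<^sub>F t in at_right 0. ((\<lambda>t. f (1 + t * h)) has_real_derivative deriv f (1 + t * h) * h) (at t)"
    using pos by eventually_elim (rule d1)
  have "((\<lambda>t. deriv f (1 + t * h) * h) has_real_derivative (deriv (deriv f) (1 + 0 * h) * h) * h) (at 0)"
    using D[OF assms(2), of "1 + 0 * h"]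
    by (intro DERIV_cmult_right, intro DERIV_chain2[of "deriv f"]) (auto intro!: derivative_eq_intros)
  then have "((\<lambda>t. deriv f (1 + t * h) * h / t) \<longlongrightarrow> deriv (deriv f) 1 * h\<^sup>2) (at 0)"
    by (simp add: DERIV_def assms(4) power2_eq_square mult.assoc)
  then have "((\<lambda>t. deriv f (1 + t * h) * h / t / 2) \<longlongrightarrow> deriv (deriv f) 1 * h\<^sup>2 / 2) (at_right 0)"
    by (intro tendsto_divide tendsto_const) (auto intro: tendsto_within_subset)
  then show "((\<lambda>t. deriv f (1 + t * h) * h / (2 * t)) \<longlongrightarrow> deriv (deriv f) 1 / 2 * h\<^sup>2) (at_right 0)"
    by (simp add: mult.commute)
  show "\<forall>\<^sub>F t in at_right (0::real). ((\<lambda>t. t\<^sup>2) has_real_derivative 2 * t) (at t)"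
    by (rule always_eventually) (auto intro!: derivative_eq_intros)
  show "((\<lambda>t::real. t\<^sup>2) \<longlongrightarrow> 0) (at_right 0)"
    by (auto intro!: tendsto_eq_intros)
  show "\<forall>\<^sub>F t in at_right (0::real). t\<^sup>2 \<noteq> 0" "\<forall>\<^sub>F t in at_right (0::real). 2 * t \<noteq> 0"
    by (auto simp: eventually_at_filter)
qed

text \<open>Both convergence theorems concern sequences, so the one-sided limit is tested along
  sequences decreasing below a bound. The majorant \<open>w\<close> is requested only for a finite
  limit integral; an infinite one is forced by Fatou's lemma.\<close>

lemma nn_integral_tendsto_at_right_0:
  fixes u :: "real \<Rightarrow> 'a \<Rightarrow> ennreal"
  assumes meas: "\<And>t. 0 < t \<Longrightarrow> t < 1 \<Longrightarrow> u t \<in> borel_measurable M"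
    and lim: "\<And>x. ((\<lambda>t. u t x) \<longlongrightarrow> v x) (at_right 0)"
    and dom: "(\<integral>\<^sup>+x. v x \<partial>M) < \<infinity> \<Longrightarrow>
      \<exists>w\<in>borel_measurable M. (\<integral>\<^sup>+x. w x \<partial>M) < \<infinity> \<and> (\<forall>\<^sub>F t in at_right 0. AE x in M. u t x \<le> w x)"
  shows "((\<lambda>t. \<integral>\<^sup>+x. u t x \<partial>M) \<longlongrightarrow> (\<integral>\<^sup>+x. v x \<partial>M)) (at_right 0)"
proof (cases "(\<integral>\<^sup>+x. v x \<partial>M) < \<infinity>")
  case True
  then obtain w where w: "w \<in> borel_measurable M" "(\<integral>\<^sup>+x. w x \<partial>M) < \<infinity>"
      "\<forall>\<^sub>F t in at_right 0. AE x in M. u t x \<le> w x"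
    using dom by blast
  then obtain b where b: "0 < b" "\<And>t. 0 < t \<Longrightarrow> t < b \<Longrightarrow> AE x in M. u t x \<le> w x"
    by (auto simp: eventually_at_right_field)
  show ?thesis
  proof (rule tendsto_at_right_sequentially)
    \<comment> \<open>Below \<open>b\<close> the majorant is valid; below 1 the integrands are known
      to be measurable.\<close>
    show "0 < min b 1" using b(1) by simp
    fix s :: "nat \<Rightarrow> real"
    assume s: "\<And>n. 0 < s n" "\<And>n. s n < min b 1" "s \<longlonglongrightarrow> 0"
    have lim_s: "(\<lambda>n. u (s n) x) \<longlonglongrightarrow> v x" for x
      using s by (intro filterlim_compose[OF lim] tendsto_imp_filterlim_at_right) simp_all
    have meas_s: "u (s n) \<in> borel_measurable M" for n
      using s(1,2)[of n] by (intro meas) auto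
    show "(\<lambda>n. \<integral>\<^sup>+x. u (s n) x \<partial>M) \<longlonglongrightarrow> (\<integral>\<^sup>+x. v x \<partial>M)"
    proof (rule nn_integral_dominated_convergence[OF meas_s _ w(1) _ w(2)])
      show "v \<in> borel_measurable M"
        by (rule borel_measurable_LIMSEQ_order[OF lim_s meas_s])
      show "AE x in M. u (s n) x \<le> w x" for n
        using s(1,2)[of n] by (intro b(2)) auto
    qed (simp add: lim_s)
  qed
next
  case False
  then have inf: "(\<integral>\<^sup>+x. v x \<partial>M) = \<infinity>"
    by (simp add: not_less top_unique)
  show ?thesis
  proof (rule tendsto_at_right_sequentially[OF zero_less_one])
    fix s :: "nat \<Rightarrow> real"
    assume s: "\<And>n. 0 < s n" "\<And>n. s n < 1" "s \<longlonglongrightarrow> 0"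
    have lim_s: "(\<lambda>n. u (s n) x) \<longlonglongrightarrow> v x" for x
      using s by (intro filterlim_compose[OF lim] tendsto_imp_filterlim_at_right) simp_all
    have "(\<integral>\<^sup>+x. v x \<partial>M) = (\<integral>\<^sup>+x. liminf (\<lambda>n. u (s n) x) \<partial>M)"
      by (intro nn_integral_cong) (simp add: lim_imp_Liminf[OF _ lim_s])
    also have "\<dots> \<le> liminf (\<lambda>n. \<integral>\<^sup>+x. u (s n) x \<partial>M)"
      using s by (intro nn_integral_liminf meas)
    finally have "liminf (\<lambda>n. \<integral>\<^sup>+x. u (s n) x \<partial>M) = \<infinity>"
      by (simp add: inf top_unique)
    \<comment> \<open>The infinite lower limit pushes the upper limit to infinity too, and their
      agreement gives convergence.\<close>
    moreover have "limsup (\<lambda>n. \<integral>\<^sup>+x. u (s n) x \<partial>M) = \<infinity>"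
      using Liminf_le_Limsup[of sequentially "\<lambda>n. \<integral>\<^sup>+x. u (s n) x \<partial>M"] calculation
      by (simp add: top_unique)
    ultimately show "(\<lambda>n. \<integral>\<^sup>+x. u (s n) x \<partial>M) \<longlonglongrightarrow> (\<integral>\<^sup>+x. v x \<partial>M)"
      by (simp add: tendsto_iff_Liminf_eq_Limsup inf)
  qed
qed

section \<open>The transport map and the geodesic\<close>

lemma DERIV_monotone_transport:
  assumes p: "p \<in> prob_densities" and q: "q \<in> prob_densities" and T: "mono T" "transports T q p"
  shows "(T has_real_derivative q x / p (T x)) (at x)"
proof (rule DERIV_strict_mono_factor)
  note pc = prob_densities_continuous[OF p] and qc = prob_densities_continuous[OF q]
    and pd = real_distribution_prob_density[OF p] and qd = real_distribution_prob_density[OF q]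
  show "strict_mono (cdf (measure_of_density p))"
    by (rule strict_mono_cdf_measure_of_density[OF pc prob_densities_pos[OF p] pd])
  show "cdf (measure_of_density p) (T y) = cdf (measure_of_density q) y" for y
    by (rule cdf_transports[OF T qd borel_measurable_continuous_onI[OF pc]])
  show "(cdf (measure_of_density q) has_real_derivative q x) (at x)"
    by (rule DERIV_cdf_measure_of_density[OF qc less_imp_le[OF prob_densities_pos[OF q]] qd])
  show "(cdf (measure_of_density p) has_real_derivative p (T x)) (at (T x))"
    by (rule DERIV_cdf_measure_of_density[OF pc less_imp_le[OF prob_densities_pos[OF p]] pd])
  show "p (T x) \<noteq> 0"
    using prob_densities_pos[OF p, of "T x"] by simp
qed

text \<open>Needed so that the Jacobian density of the interpolated map is continuous, hence the
  representative that \<open>pushforward_density\<close> selects.\<close>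

lemma continuous_on_transport_derivative:
  assumes p: "p \<in> prob_densities" and q: "q \<in> prob_densities" and T: "mono T" "transports T q p"
  shows "continuous_on UNIV (\<lambda>x. q x / p (T x))"
proof (rule continuous_on_divide[OF prob_densities_continuous[OF q]])
  have "continuous_on UNIV T"
    using DERIV_monotone_transport[OF assms] DERIV_isCont continuous_at_imp_continuous_on by blast
  then show "continuous_on UNIV (\<lambda>x. p (T x))"
    by (intro continuous_on_compose2[OF prob_densities_continuous[OF p]]) auto
  show "\<forall>x\<in>UNIV. p (T x) \<noteq> 0"
    using prob_densities_pos[OF p] by (metis less_irrefl)
qed

text \<open>The slope is the convex combination of 1 and \<open>a\<close>.\<close>

lemma interpolated_slope_pos:
  fixes a t :: real
  assumes "0 < a" "0 < t" "t < 1"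
  shows "0 < 1 + t * (a - 1)"
proof -
  have "0 < (1 - t) + t * a"
    using assms by (intro add_pos_pos mult_pos_pos) auto
  then show ?thesis
    by (simp add: algebra_simps)
qed

text \<open>The diffeomorphism lemma applies to the interpolated map, whose derivative is the
  right-hand side. The bound \<open>t < 1\<close> keeps the summand \<open>(1 - t) * x\<close> that
  makes this map onto, and is harmless for a limit at 0.\<close>

lemma transport_ratio_geodesic:
  assumes p: "p \<in> prob_densities" and q: "q \<in> prob_densities" and T: "mono T" "transports T q p"
    and t: "0 < t" "t < 1"
  shows "transport_ratio (wasserstein_geodesic q T t) q x = 1 + t * (q x / p (T x) - 1)"
proof -
  note DT = DERIV_monotone_transport[OF p q T]
  have "continuous_on UNIV T"
    using DT DERIV_isCont continuous_at_imp_continuous_on by blast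
  moreover have "((\<lambda>x. (1 - t) * x + t * T x) has_real_derivative 1 + t * (q y / p (T y) - 1)) (at y)" for y
    by (rule derivative_eq_intros DT refl)+ (simp add: algebra_simps)
  moreover have "0 < 1 + t * (q y / p (T y) - 1)" for y
    using prob_densities_pos[OF p] prob_densities_pos[OF q] t by (intro interpolated_slope_pos) auto
  moreover have "continuous_on UNIV (\<lambda>y. 1 + t * (q y / p (T y) - 1))"
    by (intro continuous_intros continuous_on_transport_derivative[OF p q T])
  ultimately show ?thesis
    unfolding wasserstein_geodesic_def
    using t T(1) prob_densities_continuous[OF q] prob_densities_pos[OF q] real_distribution_prob_density[OF q]
    by (intro transport_ratio_pushforward_density surj_convex_combination_mono) auto
qed

section \<open>Convergence of the rescaled divergence\<close>

theorem mainTheorem5: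
  fixes f p q T :: "real \<Rightarrow> real"
  assumes "\<And>u. 0 < u \<Longrightarrow> 0 \<le> f u"
    and "convex_on {0<..} f"
    and "f differentiable_on {0<..}"
    and "deriv f differentiable_on {0<..}"
    and "continuous_on {0<..} (deriv (deriv f))"
    and "f 1 = 0" and "deriv f 1 = 0"
    and "p \<in> prob_densities" and "q \<in> prob_densities"
    and "mono T" and "transports T q p"
    and "ennreal (deriv (deriv f) 1 / 2) * (\<integral>\<^sup>+x. ennreal (\<bar>deriv T x - 1\<bar>^2 * q x) \<partial>lborel) < \<infinity>
           \<Longrightarrow> dominated_near_zero f (wasserstein_geodesic q T) q"
  shows "((\<lambda>t. ennreal (1 / t^2) * transport_f_divergence f (wasserstein_geodesic q T t) q)
           \<longlongrightarrow> ennreal (deriv (deriv f) 1 / 2) *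
                (\<integral>\<^sup>+x. ennreal (\<bar>deriv T x - 1\<bar>^2 * q x) \<partial>lborel)) (at_right 0)"
proof -
  define h where "h = (\<lambda>x. deriv T x - 1)"
  define u where "u = (\<lambda>t x. f (1 + t * h x) / t\<^sup>2 * q x)"
  note pos = prob_densities_pos[OF assms(8)] prob_densities_pos[OF assms(9)]
  have h: "h x = q x / p (T x) - 1" for x
    using DERIV_imp_deriv[OF DERIV_monotone_transport[OF assms(8-11)]] by (simp add: h_def)
  have cont_h: "continuous_on UNIV h"
    unfolding h by (intro continuous_intros continuous_on_transport_derivative[OF assms(8-11)])
  then have [measurable]: "h \<in> borel_measurable borel"
    by (rule borel_measurable_continuous_onI)
  have [measurable]: "q \<in> borel_measurable borel"
    using prob_densities_continuous[OF assms(9)] by (rule borel_measurable_continuous_onI)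
  have ratio: "transport_ratio (wasserstein_geodesic q T t) q x = 1 + t * h x"
    if "0 < t" "t < 1" for t x
    using transport_ratio_geodesic[OF assms(8-11) that] by (simp add: h)
  have ratio_pos: "0 < 1 + t * h x" if "0 < t" "t < 1" for t x
    unfolding h using pos that by (intro interpolated_slope_pos) auto
  \<comment> \<open>Regularity of \<open>f\<close> is known on the positive reals only, so
    measurability is derived for the composition, whose inner function is continuous and
    positive.\<close>
  have [measurable]: "(\<lambda>x. f (1 + t * h x)) \<in> borel_measurable borel" if "0 < t" "t < 1" for t
    using ratio_pos[OF that]
    by (intro borel_measurable_continuous_onI continuous_on_compose2[OF differentiable_imp_continuous_on[OF assms(3)]]
        continuous_intros cont_h) auto
  have divergence: "ennreal (1 / t\<^sup>2) * transport_f_divergence f (wasserstein_geodesic q T t) q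
      = (\<integral>\<^sup>+x. ennreal (u t x) \<partial>lborel)" if "0 < t" "t < 1" for t
    using that
    by (simp add: transport_f_divergence_def u_def ratio ennreal_mult'[symmetric] flip: nn_integral_cmult)
  \<comment> \<open>Splitting \<open>ennreal\<close> of the product rests on
    \<open>(h x)\<^sup>2 * q x\<close> being nonnegative.\<close>
  have limit: "ennreal (deriv (deriv f) 1 / 2) * (\<integral>\<^sup>+x. ennreal (\<bar>deriv T x - 1\<bar>^2 * q x) \<partial>lborel)
      = (\<integral>\<^sup>+x. ennreal (deriv (deriv f) 1 / 2 * (h x)\<^sup>2 * q x) \<partial>lborel)"
    unfolding h_def[THEN fun_cong, symmetric] using pos(2)
    by (subst nn_integral_cmult[symmetric])
       (auto simp: ennreal_mult''[symmetric] less_imp_le mult.assoc)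
  have "((\<lambda>t. \<integral>\<^sup>+x. ennreal (u t x) \<partial>lborel)
      \<longlongrightarrow> (\<integral>\<^sup>+x. ennreal (deriv (deriv f) 1 / 2 * (h x)\<^sup>2 * q x) \<partial>lborel)) (at_right 0)"
  proof (rule nn_integral_tendsto_at_right_0)
    show "(\<lambda>x. ennreal (u t x)) \<in> borel_measurable lborel" if "0 < t" "t < 1" for t
      using that unfolding u_def by measurable
    show "((\<lambda>t. ennreal (u t x)) \<longlongrightarrow> ennreal (deriv (deriv f) 1 / 2 * (h x)\<^sup>2 * q x)) (at_right 0)" for x
      unfolding u_def
      by (intro tendsto_ennrealI tendsto_mult tendsto_const second_order_Taylor_limit[OF assms(3,4,6,7)])
  next
    assume "(\<integral>\<^sup>+x. ennreal (deriv (deriv f) 1 / 2 * (h x)\<^sup>2 * q x) \<partial>lborel) < \<infinity>"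
    then have "dominated_near_zero f (wasserstein_geodesic q T) q"
      using assms(12) by (simp only: limit)
    then obtain g where g: "integrable lborel (\<lambda>x. g x * q x)"
        "\<forall>\<^sub>F t in at_right 0. AE x in lborel. f (transport_ratio (wasserstein_geodesic q T t) q x) / t\<^sup>2 \<le> g x"
      unfolding dominated_near_zero_def by blast
    show "\<exists>w\<in>borel_measurable lborel. (\<integral>\<^sup>+x. w x \<partial>lborel) < \<infinity> \<and>
        (\<forall>\<^sub>F t in at_right 0. AE x in lborel. ennreal (u t x) \<le> w x)"
    proof (intro bexI conjI)
      \<comment> \<open>The majorant is \<open>g * q\<close>. Where \<open>g\<close> is negative
        \<open>ennreal\<close> gives 0, so the integral is bounded by that of the norm.\<close>
      show "(\<lambda>x. ennreal (g x * q x)) \<in> borel_measurable lborel"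
        using borel_measurable_integrable[OF g(1)] by measurable
      have "(\<integral>\<^sup>+x. ennreal (g x * q x) \<partial>lborel) \<le> (\<integral>\<^sup>+x. ennreal (norm (g x * q x)) \<partial>lborel)"
        by (intro nn_integral_mono ennreal_leI) simp
      also have "\<dots> < \<infinity>"
        using g(1) by (simp add: integrable_iff_bounded)
      finally show "(\<integral>\<^sup>+x. ennreal (g x * q x) \<partial>lborel) < \<infinity>" .
      \<comment> \<open>Only for these \<open>t\<close> is the transport ratio known to be
        \<open>1 + t * h x\<close>, which turns the bound in \<open>g\<close> into one on
        \<open>u t\<close>.\<close>
      have "\<forall>\<^sub>F t in at_right (0::real). 0 < t \<and> t < 1"
        using eventually_at_right_real[OF zero_less_one] by eventually_elim simp
      with g(2) show "\<forall>\<^sub>F t in at_right 0. AE x in lborel. ennreal (u t x) \<le> ennreal (g x * q x)"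
      proof eventually_elim
        case (elim t)
        from elim(1) show ?case
        proof eventually_elim
          case (elim x)
          then have "f (1 + t * h x) / t\<^sup>2 \<le> g x"
            using ratio \<open>0 < t \<and> t < 1\<close> by simp
          then show ?case
            unfolding u_def using pos(2)[of x] by (intro ennreal_leI mult_right_mono) auto
        qed
      qed
    qed
  qed
  then show ?thesis
    unfolding limit
  proof (rule Lim_transform_eventually)
    show "\<forall>\<^sub>F t in at_right 0. (\<integral>\<^sup>+x. ennreal (u t x) \<partial>lborel)
        = ennreal (1 / t\<^sup>2) * transport_f_divergence f (wasserstein_geodesic q T t) q"
      using eventually_at_right_real[OF zero_less_one] by eventually_elim (simp add: divergence)
  qed
qed

end
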